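(* Let $W$ be a quasidefinite $N\times N$ matrix of measures and let $\{V_n\}_{n\in\mathbb N}$, $\{G_n\}_{n\in\mathbb N}$ be its biorthogonal matrix polynomial sequences. Then for each $n$, $V_n$ and $G_n$ have the same zeros.
   Context: $N\ge1$ is fixed, $\mathbb N=\{0,1,2,\dots\}$, $I_N$ and $\mathbf 0_N$ are the $N\times N$ identity and zero matrices. A quasidefinite $N\times N$ matrix of measures is a matrix $W=(w_{i,j})_{i,j=0}^{N-1}$ of measures supported on the real line ($W$ is not necessarily positive definite) with finite moments $U_n=\int x^n\,dW(x)$ such that $\det\bigl((U_{i+j})_{i,j=0}^{n}\bigr)\ne0$ for all $n\in\mathbb N$; it is normalized by $U_0=I_N$. Sequences of matrix polynomials $\{V_n\},\{G_n\}\subset\mathbb C^{N\times N}[x]$ with $\deg V_n=\deg G_n=n$ are biorthogonal with respect to $W$ if $\int V_n(x)\,dW(x)\,x^m=\Omega_n^{(1)}\delta_{n,m}$ and $\int x^m\,dW(x)\,G_n(x)=\Omega_n^{(2)}\delta_{n,m}$ for $m=0,\dots,n$, with $\Omega_n^{(1)},\Omega_n^{(2)}$ nonsingular, and $\int V_n(x)\,dW(x)\,G_m(x)=I_N\delta_{n,m}$ for all $n,m\in\mathbb N$. They satisfy, for $n\in\mathbb N$, $xV_n(x)=A_nV_{n+1}(x)+B_nV_n(x)+C_nV_{n-1}(x)$ and $xG_n(x)=G_{n-1}(x)A_{n-1}+G_n(x)B_n+G_{n+1}(x)C_{n+1}$ with $V_{-1}=G_{-1}=\mathbf 0_N$, $V_0=G_0=I_N$,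 and $A_n$, $C_n$ nonsingular. A zero of a matrix polynomial $P$ is a zero of $\det P$. *)

theory Defs
  imports
    "HOL-Analysis.Bochner_Integration"
    "HOL-Computational_Algebra.Polynomial"
    "Jordan_Normal_Form.Determinant"
begin

section \<open>Complex measures on the real line\<close>

text \<open>
  A complex Borel measure is a countably additive complex-valued set function, hence automatically
  of finite total variation.  Its values on non-Borel sets are irrelevant.
\<close>

definition complex_measure :: "(real set \<Rightarrow> complex) \<Rightarrow> bool" where
  "complex_measure \<nu> \<longleftrightarrow>
     (\<forall>A :: nat \<Rightarrow> real set. range A \<subseteq> sets borel \<longrightarrow> disjoint_family A \<longrightarrow>
        (\<lambda>n. \<nu> (A n)) sums \<nu> (\<Union>n. A n))"

text \<open>
  The positive part \<open>\<phi>\<^sup>+(A) = sup {\<phi>(B) | B \<subseteq> A}\<close> of the Jordan decomposition of a signed measure;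
  the negative part is the positive part of \<open>-\<phi>\<close>.  The function \<^term>\<open>ennreal\<close> truncates negative
  values to 0, which does not affect the supremum because \<open>B = {}\<close> already contributes the value 0.
\<close>

definition positive_variation :: "(real set \<Rightarrow> real) \<Rightarrow> real measure" where
  "positive_variation \<phi> =
     measure_of UNIV (sets borel) (\<lambda>A. SUP B\<in>{B \<in> sets borel. B \<subseteq> A}. ennreal (\<phi> B))"

text \<open>
  Since \<^const>\<open>measure_of\<close> yields the zero measure when the given set function is not a measure, we
  record that the supremum above does define a measure.
\<close>

lemma emeasure_positive_variation:
  fixes \<phi> :: "real set \<Rightarrow> real"
  assumes \<phi>: "\<And>A :: nat \<Rightarrow> real set. range A \<subseteq> sets borel \<Longrightarrow> disjoint_family A \<Longrightarrow>
                (\<lambda>n. \<phi> (A n)) sums \<phi> (\<Union>n. A n)"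
    and A: "A \<in> sets borel"
  shows "emeasure (positive_variation \<phi>) A = (SUP B\<in>{B \<in> sets borel. B \<subseteq> A}. ennreal (\<phi> B))"
proof -
  define \<nu> where "\<nu> = (\<lambda>A. SUP B\<in>{B \<in> sets borel. B \<subseteq> A}. ennreal (\<phi> B))"
  have \<nu>_eq: "\<nu> A = (SUP B\<in>{B \<in> sets borel. B \<subseteq> A}. ennreal (\<phi> B))" for A
    by (simp add: \<nu>_def)
  have empty: "\<phi> {} = 0"
  proof -
    have "(\<lambda>n::nat. \<phi> {}) sums \<phi> {}"
      using \<phi>[of "\<lambda>_. {}"] by (simp add: disjoint_family_on_def)
    then show ?thesis
      by (simp add: sums_iff summable_const_iff)
  qed
  have Un: "\<phi> (B \<union> C) = \<phi> B + \<phi> C"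
    if "B \<in> sets borel" "C \<in> sets borel" "B \<inter> C = {}" for B C
  proof -
    have "(\<lambda>n. \<phi> (binaryset B C n)) sums \<phi> (\<Union>n. binaryset B C n)"
      by (rule \<phi>) (use that in \<open>auto simp: range_binaryset_eq disjoint_family_on_def binaryset_def\<close>)
    moreover have "(\<lambda>n. \<phi> (binaryset B C n)) sums (\<phi> B + \<phi> C)"
      by (rule binaryset_sums) (rule empty)
    ultimately show ?thesis
      using sums_unique2 UN_binaryset_eq by metis
  qed
  have up: "ennreal (\<phi> B) \<le> \<nu> A" if "B \<in> sets borel" "B \<subseteq> A" for A B
    unfolding \<nu>_def using that by (intro SUP_upper) auto
  have \<nu>_empty: "\<nu> {} = 0"
    unfolding \<nu>_def by (auto intro!: antisym SUP_least simp: empty)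
  have mono: "\<nu> A \<le> \<nu> B" if "A \<subseteq> B" for A B
    unfolding \<nu>_def using that by (intro SUP_subset_mono) auto
  have superadd: "\<nu> A + \<nu> B \<le> \<nu> (A \<union> B)"
    if "A \<in> sets borel" "B \<in> sets borel" "A \<inter> B = {}" for A B
  proof -
    have 1: "ennreal (\<phi> C) + ennreal (\<phi> D) \<le> \<nu> (A \<union> B)"
      if CD: "C \<in> sets borel" "C \<subseteq> A" "D \<in> sets borel" "D \<subseteq> B" for C D
    proof (cases "\<phi> C \<le> 0 \<or> \<phi> D \<le> 0")
      case True
      have "ennreal (\<phi> C) \<le> \<nu> (A \<union> B)" "ennreal (\<phi> D) \<le> \<nu> (A \<union> B)"
        using CD by (auto intro!: up)
      with True show ?thesis
        by (auto simp: ennreal_neg)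
    next
      case False
      moreover have "C \<inter> D = {}"
        using CD \<open>A \<inter> B = {}\<close> by blast
      ultimately have "ennreal (\<phi> C) + ennreal (\<phi> D) = ennreal (\<phi> (C \<union> D))"
        using Un[of C D] CD by (simp add: ennreal_plus)
      also have "\<dots> \<le> \<nu> (A \<union> B)"
        using CD by (intro up) auto
      finally show ?thesis .
    qed
    have ne: "{C \<in> sets borel. C \<subseteq> X} \<noteq> {}" for X :: "real set"
      by auto
    have 2: "ennreal (\<phi> C) + \<nu> B \<le> \<nu> (A \<union> B)" if "C \<in> sets borel" "C \<subseteq> A" for C
      unfolding \<nu>_eq[of B]
      by (subst ennreal_SUP_add_right) (use 1 that ne in \<open>auto intro!: SUP_least\<close>)
    show ?thesis
      unfolding \<nu>_eq[of A]
      by (subst ennreal_SUP_add_left[symmetric]) (use 2 ne in \<open>auto intro!: SUP_least\<close>)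
  qed
  have ca: "countably_additive (sets borel) \<nu>"
    unfolding countably_additive_def
  proof (intro allI impI antisym)
    fix A :: "nat \<Rightarrow> real set"
    assume A: "range A \<subseteq> sets borel" "disjoint_family A"
    have part: "(\<Sum>i<n. \<nu> (A i)) \<le> \<nu> (\<Union>i<n. A i)" for n
    proof (induction n)
      case (Suc n)
      have "(\<Sum>i<Suc n. \<nu> (A i)) \<le> \<nu> (\<Union>i<n. A i) + \<nu> (A n)"
        using Suc by (simp add: add_mono)
      also have "\<dots> \<le> \<nu> ((\<Union>i<n. A i) \<union> A n)"
      proof (rule superadd)
        show "(\<Union>i<n. A i) \<inter> A n = {}"
        proof -
          have "A i \<inter> A n = {}" if "i < n" for i
            using A(2) that by (simp add: disjoint_family_on_def)
          then show ?thesis by blast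
        qed
      qed (use A(1) in auto)
      also have "(\<Union>i<n. A i) \<union> A n = (\<Union>i<Suc n. A i)"
        by (auto simp: less_Suc_eq)
      finally show ?case .
    qed (simp add: \<nu>_empty)
    show "(\<Sum>i. \<nu> (A i)) \<le> \<nu> (\<Union>i. A i)"
      unfolding suminf_eq_SUP
      by (rule SUP_least, rule order_trans[OF part], rule mono) auto
    show "\<nu> (\<Union>i. A i) \<le> (\<Sum>i. \<nu> (A i))"
      unfolding \<nu>_eq[of "\<Union>i. A i"]
    proof (rule SUP_least)
      fix B assume "B \<in> {B \<in> sets borel. B \<subseteq> (\<Union>i. A i)}"
      then have B: "B \<in> sets borel" "(\<Union>i. B \<inter> A i) = B"
        by auto
      have "(\<lambda>i. \<phi> (B \<inter> A i)) sums \<phi> (\<Union>i. B \<inter> A i)"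
      proof (rule \<phi>)
        show "range (\<lambda>i. B \<inter> A i) \<subseteq> sets borel"
          using A(1) B(1) by auto
        show "disjoint_family (\<lambda>i. B \<inter> A i)"
          using A(2) by (rule disjoint_family_on_bisimulation) auto
      qed
      then have "(\<lambda>n. \<Sum>i<n. \<phi> (B \<inter> A i)) \<longlonglongrightarrow> \<phi> B"
        unfolding B(2) sums_def .
      then have "(\<lambda>n. ennreal (\<Sum>i<n. \<phi> (B \<inter> A i))) \<longlonglongrightarrow> ennreal (\<phi> B)"
        by (rule tendsto_ennrealI)
      moreover have "ennreal (\<Sum>i<n. \<phi> (B \<inter> A i)) \<le> (\<Sum>i. \<nu> (A i))" for n
      proof -
        have "ennreal (\<Sum>i<n. \<phi> (B \<inter> A i)) \<le> ennreal (\<Sum>i<n. max 0 (\<phi> (B \<inter> A i)))"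
          by (intro ennreal_leI sum_mono) auto
        also have "\<dots> = (\<Sum>i<n. ennreal (\<phi> (B \<inter> A i)))"
        proof -
          have "ennreal (max 0 r) = ennreal r" for r
            by (auto simp: max_def ennreal_neg)
          then show ?thesis
            by (simp flip: sum_ennreal)
        qed
        also have "\<dots> \<le> (\<Sum>i<n. \<nu> (A i))"
          using A(1) B(1) by (intro sum_mono up) auto
        also have "\<dots> \<le> (\<Sum>i. \<nu> (A i))"
          by (rule sum_le_suminf) auto
        finally show ?thesis .
      qed
      ultimately show "ennreal (\<phi> B) \<le> (\<Sum>i. \<nu> (A i))"
        by (intro LIMSEQ_le_const2) auto
    qed
  qed
  have "sigma_algebra UNIV (sets (borel :: real measure))"
    using sets.sigma_algebra_axioms[of "borel :: real measure"] by simp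
  moreover have "positive (sets borel) \<nu>"
    by (simp add: positive_def \<nu>_empty)
  ultimately have "emeasure (measure_of UNIV (sets borel) \<nu>) A = \<nu> A"
    using ca A by (rule emeasure_measure_of_sigma)
  then show ?thesis
    by (simp add: positive_variation_def \<nu>_def)
qed

definition complex_measure_integrable :: "(real set \<Rightarrow> complex) \<Rightarrow> (real \<Rightarrow> complex) \<Rightarrow> bool" where
  "complex_measure_integrable \<nu> f \<longleftrightarrow>
     integrable (positive_variation (\<lambda>A. Re (\<nu> A))) f \<and>
     integrable (positive_variation (\<lambda>A. - Re (\<nu> A))) f \<and>
     integrable (positive_variation (\<lambda>A. Im (\<nu> A))) f \<and>
     integrable (positive_variation (\<lambda>A. - Im (\<nu> A))) f"

definition complex_measure_integral :: "(real set \<Rightarrow> complex) \<Rightarrow> (real \<Rightarrow> complex) \<Rightarrow> complex" where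
  "complex_measure_integral \<nu> f =
     (integral\<^sup>L (positive_variation (\<lambda>A. Re (\<nu> A))) f
        - integral\<^sup>L (positive_variation (\<lambda>A. - Re (\<nu> A))) f)
     + \<i> * (integral\<^sup>L (positive_variation (\<lambda>A. Im (\<nu> A))) f
        - integral\<^sup>L (positive_variation (\<lambda>A. - Im (\<nu> A))) f)"

section \<open>Matrices of measures\<close>

definition moment :: "nat \<Rightarrow> (real set \<Rightarrow> complex) mat \<Rightarrow> nat \<Rightarrow> complex mat" where
  "moment N W n =
     mat N N (\<lambda>(i, j). complex_measure_integral (W $$ (i, j)) (\<lambda>x. of_real x ^ n))"

text \<open>
  The block matrix \<open>(U\<^bsub>i+j\<^esub>)\<close> with \<open>i, j = 0, \<dots>, n\<close>, flattened: row \<open>r\<close> lies in block row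
  \<open>r div N\<close>, at position \<open>r mod N\<close>, and similarly for columns.
\<close>

definition block_hankel :: "nat \<Rightarrow> (nat \<Rightarrow> complex mat) \<Rightarrow> nat \<Rightarrow> complex mat" where
  "block_hankel N U n =
     mat ((n + 1) * N) ((n + 1) * N)
       (\<lambda>(r, c). U (r div N + c div N) $$ (r mod N, c mod N))"

definition quasidefinite :: "nat \<Rightarrow> (real set \<Rightarrow> complex) mat \<Rightarrow> bool" where
  "quasidefinite N W \<longleftrightarrow>
     W \<in> carrier_mat N N \<and>
     (\<forall>i<N. \<forall>j<N. complex_measure (W $$ (i, j)) \<and>
        (\<forall>n. complex_measure_integrable (W $$ (i, j)) (\<lambda>x. of_real x ^ n))) \<and>
     (\<forall>n. det (block_hankel N (moment N W) n) \<noteq> 0)"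

section \<open>Matrix polynomials\<close>

text \<open>
  Matrix polynomials are matrices with polynomial entries; the degree of such a matrix is the
  largest exponent with a nonzero matrix coefficient.
\<close>

definition mat_poly_degree :: "complex poly mat \<Rightarrow> nat" where
  "mat_poly_degree P = Max (degree ` elements_mat P)"

definition mat_poly_zeros :: "complex poly mat \<Rightarrow> complex set" where
  "mat_poly_zeros P = {z. poly (det P) z = 0}"

definition x_power :: "nat \<Rightarrow> nat \<Rightarrow> complex poly mat" where
  "x_power N m = monom 1 m \<cdot>\<^sub>m 1\<^sub>m N"

text \<open>The matrix integral \<open>\<integral> P(x) dW(x) Q(x)\<close>.\<close>

definition mat_integral ::
  "nat \<Rightarrow> (real set \<Rightarrow> complex) mat \<Rightarrow> complex poly mat \<Rightarrow> complex poly mat \<Rightarrow> complex mat" where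
  "mat_integral N W P Q =
     mat N N (\<lambda>(i, j). \<Sum>k<N. \<Sum>l<N.
       complex_measure_integral (W $$ (k, l))
         (\<lambda>x. poly (P $$ (i, k)) (of_real x) * poly (Q $$ (l, j)) (of_real x)))"

definition biorthogonal ::
  "nat \<Rightarrow> (real set \<Rightarrow> complex) mat \<Rightarrow> (nat \<Rightarrow> complex poly mat) \<Rightarrow> (nat \<Rightarrow> complex poly mat) \<Rightarrow> bool"
  where
  "biorthogonal N W V G \<longleftrightarrow>
     (\<forall>n. V n \<in> carrier_mat N N \<and> mat_poly_degree (V n) = n) \<and>
     (\<forall>n. G n \<in> carrier_mat N N \<and> mat_poly_degree (G n) = n) \<and>
     (\<exists>\<Omega>1 \<Omega>2. \<forall>n.
        \<Omega>1 n \<in> carrier_mat N N \<and> det (\<Omega>1 n) \<noteq> 0 \<and>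
        \<Omega>2 n \<in> carrier_mat N N \<and> det (\<Omega>2 n) \<noteq> 0 \<and>
        (\<forall>m\<le>n. mat_integral N W (V n) (x_power N m) = (if n = m then \<Omega>1 n else 0\<^sub>m N N) \<and>
                mat_integral N W (x_power N m) (G n) = (if n = m then \<Omega>2 n else 0\<^sub>m N N))) \<and>
     (\<forall>n m. mat_integral N W (V n) (G m) = (if n = m then 1\<^sub>m N else 0\<^sub>m N N))"

end

theory Submission
  imports Defs
begin

text \<open>
  A row vector \<open>u\<close> in the left kernel of \<open>V\<^sub>n(z)\<close> gives \<open>u V\<^sub>n(x) = (x - z) r(x)\<close> with a nonzero row
  polynomial \<open>r\<close> of degree less than \<open>n\<close>, and orthogonality of \<open>V\<^sub>n\<close> to \<open>x\<^sup>m\<close> for \<open>m < n\<close> says that the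
  coefficients of \<open>r\<close> lie in the left kernel of the shifted block Hankel matrix
  \<open>H = (U\<^bsub>i+j+1\<^esub> - z U\<^bsub>i+j\<^esub>)\<close> with \<open>i, j < n\<close>.  Quasidefiniteness makes this reversible, so \<open>z\<close> is a
  zero of \<open>V\<^sub>n\<close> iff \<open>det H = 0\<close>.  Transposing everything gives the same criterion for \<open>G\<^sub>n\<close>.
\<close>

section \<open>Left kernels, Cramer's rule and evaluation of determinants\<close>

text \<open>A left kernel is the column kernel of the transpose. The vector is a plain function, so
  that its values can serve directly as coefficients in sums of polynomials.\<close>

lemma det_0_iff_row_kernel:
  fixes A :: "'a :: idom mat"
  assumes A: "A \<in> carrier_mat n n"
  shows "det A = 0 \<longleftrightarrow> (\<exists>u. (\<exists>i<n. u i \<noteq> 0) \<and> (\<forall>j<n. (\<Sum>i<n. u i * A $$ (i, j)) = 0))"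
proof -
  have T: "A\<^sup>T \<in> carrier_mat n n" using A by simp
  have mult: "A\<^sup>T *\<^sub>v v = 0\<^sub>v n \<longleftrightarrow> (\<forall>j<n. (\<Sum>i<n. v $ i * A $$ (i, j)) = 0)"
    if "v \<in> carrier_vec n" for v
    using A that by (auto simp: vec_eq_iff scalar_prod_def mult.commute lessThan_atLeast0)
  have "det A = 0 \<longleftrightarrow> det A\<^sup>T = 0" using det_transpose[OF A] by simp
  also have "\<dots> \<longleftrightarrow> (\<exists>v. v \<in> carrier_vec n \<and> v \<noteq> 0\<^sub>v n \<and> A\<^sup>T *\<^sub>v v = 0\<^sub>v n)"
    by (rule det_0_iff_vec_prod_zero[OF T])
  also have "\<dots> \<longleftrightarrow> (\<exists>u. (\<exists>i<n. u i \<noteq> 0) \<and> (\<forall>j<n. (\<Sum>i<n. u i * A $$ (i, j)) = 0))"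
  proof
    assume "\<exists>v. v \<in> carrier_vec n \<and> v \<noteq> 0\<^sub>v n \<and> A\<^sup>T *\<^sub>v v = 0\<^sub>v n"
    then obtain v where v: "v \<in> carrier_vec n" "v \<noteq> 0\<^sub>v n" "A\<^sup>T *\<^sub>v v = 0\<^sub>v n" by blast
    have "\<exists>i<n. v $ i \<noteq> 0" using v(1,2) by (auto simp: vec_eq_iff)
    then show "\<exists>u. (\<exists>i<n. u i \<noteq> 0) \<and> (\<forall>j<n. (\<Sum>i<n. u i * A $$ (i, j)) = 0)"
      using mult[OF v(1)] v(3) by (intro exI[of _ "\<lambda>i. v $ i"]) auto
  next
    assume "\<exists>u. (\<exists>i<n. u i \<noteq> 0) \<and> (\<forall>j<n. (\<Sum>i<n. u i * A $$ (i, j)) = 0)"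
    then obtain u where u: "\<exists>i<n. u i \<noteq> 0" "\<forall>j<n. (\<Sum>i<n. u i * A $$ (i, j)) = 0" by blast
    have "vec n u \<noteq> 0\<^sub>v n" using u(1) by (auto simp: vec_eq_iff)
    moreover have "A\<^sup>T *\<^sub>v vec n u = 0\<^sub>v n"
      by (subst mult) (use u(2) in auto)
    ultimately show "\<exists>v. v \<in> carrier_vec n \<and> v \<noteq> 0\<^sub>v n \<and> A\<^sup>T *\<^sub>v v = 0\<^sub>v n"
      by (intro exI[of _ "vec n u"]) auto
  qed
  finally show ?thesis .
qed

text \<open>Cramer's rule: \<open>c\<close> is the row \<open>b\<close> times the adjugate, divided
  by \<open>det A\<close>. The closing \<open>show\<close> supplies this witness.\<close>

lemma row_system_solvable:
  fixes A :: "'a :: field mat"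
  assumes A: "A \<in> carrier_mat n n" and det: "det A \<noteq> 0"
  obtains c where "\<And>j. j < n \<Longrightarrow> (\<Sum>i<n. c i * A $$ (i, j)) = b j"
proof
  fix j assume j: "j < n"
  define B where "B = adj_mat A"
  have B: "B \<in> carrier_mat n n" "B * A = det A \<cdot>\<^sub>m 1\<^sub>m n"
    using adj_mat[OF A] by (auto simp: B_def)
  have BA: "(\<Sum>i<n. B $$ (l, i) * A $$ (i, j)) = (if l = j then det A else 0)" if "l < n" for l
  proof -
    have "(B * A) $$ (l, j) = (\<Sum>i<n. B $$ (l, i) * A $$ (i, j))"
      using A B(1) that j by (auto simp: scalar_prod_def lessThan_atLeast0)
    then show ?thesis using B(2) that j by auto
  qed
  have "(\<Sum>i<n. (\<Sum>l<n. b l * B $$ (l, i) / det A) * A $$ (i, j)) =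
        (\<Sum>l<n. \<Sum>i<n. b l / det A * (B $$ (l, i) * A $$ (i, j)))"
    by (simp add: sum_distrib_right mult.assoc) (rule sum.swap)
  also have "\<dots> = (\<Sum>l<n. b l / det A * (if l = j then det A else 0))"
    by (rule sum.cong) (simp_all only: sum_distrib_left[symmetric] BA lessThan_iff)
  also have "\<dots> = b j" using j det by (simp add: if_distrib cong: if_cong)
  finally show "(\<Sum>i<n. (\<Sum>l<n. b l * B $$ (l, i) / det A) * A $$ (i, j)) = b j" .
qed

text \<open>Evaluation at \<open>z\<close> is a ring homomorphism and so passes through the Leibniz
  expansion.\<close>

lemma poly_det:
  fixes P :: "'a :: comm_ring_1 poly mat"
  assumes "P \<in> carrier_mat n n"
  shows "poly (det P) z = det (map_mat (\<lambda>p. poly p z) P)"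
proof -
  have entry: "map_mat (\<lambda>p. poly p z) P $$ (i, p i) = poly (P $$ (i, p i)) z"
    if "p permutes {0..<n}" "i < n" for p i
    using assms that permutes_in_image[OF that(1), of i] by simp
  have "poly (det P) z =
    (\<Sum>p | p permutes {0..<n}. signof p * (\<Prod>i = 0..<n. poly (P $$ (i, p i)) z))"
    using assms by (simp add: det_def' poly_sum poly_prod poly_mult sign_def)
  also have "\<dots> = det (map_mat (\<lambda>p. poly p z) P)"
    using assms by (simp add: det_def' entry)
  finally show ?thesis .
qed

section \<open>Flattened block indices\<close>

lemma sum_lessThan_mult:
  fixes f :: "nat \<Rightarrow> 'a :: comm_monoid_add"
  shows "sum f {..<n * N} = (\<Sum>i<n. \<Sum>k<N. f (i * N + k))"
proof -
  have "sum f {i * N..<i * N + N} = (\<Sum>k<N. f (i * N + k))" for i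
    using sum.shift_bounds_nat_ivl[of f 0 "i * N" N]
    by (simp add: lessThan_atLeast0 add.commute)
  then show ?thesis by (simp flip: sum.nat_group)
qed

lemma block_index_less:
  fixes i k n N :: nat
  assumes "i < n" "k < N"
  shows "i * N + k < n * N"
proof -
  have "i * N + k < Suc i * N" using assms(2) by simp
  also have "\<dots> \<le> n * N" using assms(1) by (intro mult_le_mono1) simp
  finally show ?thesis .
qed

section \<open>Matrices of linear functionals and their block Gram matrices\<close>

text \<open>\<open>L k l p\<close> stands for \<open>\<integral> p(x) dw\<^bsub>k,l\<^esub>(x)\<close>.\<close>

locale functional_matrix =
  fixes N :: nat and L :: "nat \<Rightarrow> nat \<Rightarrow> 'a :: field poly \<Rightarrow> 'a"
  assumes L_add: "k < N \<Longrightarrow> l < N \<Longrightarrow> L k l (p + q) = L k l p + L k l q"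
    and L_smult: "k < N \<Longrightarrow> l < N \<Longrightarrow> L k l (smult a p) = a * L k l p"
begin

lemma L_0: "k < N \<Longrightarrow> l < N \<Longrightarrow> L k l 0 = 0"
  using L_smult[of k l 0 0] by simp

lemma L_diff: "k < N \<Longrightarrow> l < N \<Longrightarrow> L k l (p - q) = L k l p - L k l q"
  using L_add[of k l "p - q" q] by simp

lemma L_sum: "k < N \<Longrightarrow> l < N \<Longrightarrow> L k l (\<Sum>i\<in>A. f i) = (\<Sum>i\<in>A. L k l (f i))"
  by (induction A rule: infinite_finite_induct) (simp_all add: L_0 L_add)

lemma L_sum_smult_mult:
  assumes "k < N" "l < N"
  shows "L k l ((\<Sum>i\<in>A. smult (c i) (p i)) * q) = (\<Sum>i\<in>A. c i * L k l (p i * q))"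
  using assms by (simp add: sum_distrib_right L_sum L_smult)

text \<open>For \<open>g = 1\<close> this is the block Hankel matrix of the moments; for
  \<open>g = [:-z, 1:]\<close> it is the shifted matrix \<open>H\<close>.\<close>

definition gram :: "'a poly \<Rightarrow> nat \<Rightarrow> 'a mat" where
  "gram g n = mat (n * N) (n * N)
     (\<lambda>(r, c). L (r mod N) (c mod N) (g * monom 1 (r div N + c div N)))"

lemma gram_carrier [simp]: "gram g n \<in> carrier_mat (n * N) (n * N)"
  by (simp add: gram_def)

text \<open>A row vector of length \<open>n * N\<close> encodes a row of \<open>N\<close>
  polynomials of degree less than \<open>n\<close>: the entry at \<open>i * N + k\<close> is the
  coefficient of x^i in the k-th one. Multiplying by column \<open>j * N + l\<close> then pairs the
  row, weighted by \<open>g\<close>, with x^j in the l-th coordinate.\<close>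

lemma sum_gram:
  assumes "j < n" "l < N"
  shows "(\<Sum>r<n * N. u r * gram g n $$ (r, j * N + l)) =
    (\<Sum>k<N. L k l (g * (\<Sum>i<n. monom (u (i * N + k)) i) * monom 1 j))"
proof -
  have "(\<Sum>r<n * N. u r * gram g n $$ (r, j * N + l)) =
      (\<Sum>i<n. \<Sum>k<N. u (i * N + k) * L k l (g * monom 1 (i + j)))"
    unfolding sum_lessThan_mult
    using assms by (intro sum.cong refl) (simp add: gram_def block_index_less)
  also have "\<dots> = (\<Sum>k<N. \<Sum>i<n. L k l (g * monom (u (i * N + k)) i * monom 1 j))"
  proof (subst sum.swap, intro sum.cong refl)
    fix k i assume "k \<in> {..<N}"
    moreover have "g * monom (u (i * N + k)) i * monom 1 j =
        smult (u (i * N + k)) (g * monom 1 (i + j))"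
      by (simp add: mult_monom mult.assoc flip: mult_smult_right add: smult_monom)
    ultimately show "u (i * N + k) * L k l (g * monom 1 (i + j)) =
        L k l (g * monom (u (i * N + k)) i * monom 1 j)"
      using assms(2) by (simp add: L_smult)
  qed
  also have "\<dots> = (\<Sum>k<N. L k l (g * (\<Sum>i<n. monom (u (i * N + k)) i) * monom 1 j))"
    using assms(2) by (intro sum.cong refl) (simp add: sum_distrib_left sum_distrib_right L_sum)
  finally show ?thesis .
qed

text \<open>This translates left kernel vectors into rows of polynomials by the encoding of
  \<open>sum_gram\<close>. The degree bound is stated through coefficients, so that for
  \<open>n = 0\<close> it leaves only the zero row, in accordance with the empty determinant
  1.\<close>

lemma det_gram_0_iff:
  "det (gram g n) = 0 \<longleftrightarrow>
    (\<exists>p. (\<forall>k<N. \<forall>i\<ge>n. coeff (p k) i = 0) \<and> (\<exists>k<N. p k \<noteq> 0) \<and>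
      (\<forall>m<n. \<forall>l<N. (\<Sum>k<N. L k l (g * p k * monom 1 m)) = 0))"
  (is "_ \<longleftrightarrow> (\<exists>p. ?R p)")
proof
  assume "det (gram g n) = 0"
  then obtain u r where u: "r < n * N" "u r \<noteq> 0"
    "\<And>c. c < n * N \<Longrightarrow> (\<Sum>r<n * N. u r * gram g n $$ (r, c)) = 0"
    unfolding det_0_iff_row_kernel[OF gram_carrier] by blast
  define p where "p k = (\<Sum>i<n. monom (u (i * N + k)) i)" for k
  have coeff_p: "coeff (p k) i = (if i < n then u (i * N + k) else 0)" for k i
    by (simp add: p_def coeff_sum coeff_monom)
  have N: "N > 0" using u(1) by (cases N) auto
  have "r div N < n" using u(1) by (simp add: less_mult_imp_div_less)
  then have "coeff (p (r mod N)) (r div N) \<noteq> 0" using u(2) by (simp add: coeff_p)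
  then have "p (r mod N) \<noteq> 0" by auto
  then have "\<exists>k<N. p k \<noteq> 0" using N mod_less_divisor by blast
  moreover have "(\<Sum>k<N. L k l (g * p k * monom 1 m)) = 0" if "m < n" "l < N" for m l
    using sum_gram[OF that, of u g] u(3)[OF block_index_less[OF that]] by (simp add: p_def)
  ultimately have "?R p" by (simp add: coeff_p)
  then show "\<exists>p. ?R p" by (rule exI[of _ p])
next
  assume "\<exists>p. ?R p"
  then obtain p k where p: "\<And>k i. k < N \<Longrightarrow> i \<ge> n \<Longrightarrow> coeff (p k) i = 0" "k < N" "p k \<noteq> 0"
    "\<And>m l. m < n \<Longrightarrow> l < N \<Longrightarrow> (\<Sum>k<N. L k l (g * p k * monom 1 m)) = 0"
    by blast
  define u where "u r = coeff (p (r mod N)) (r div N)" for r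
  have pk: "(\<Sum>i<n. monom (u (i * N + k)) i) = p k" if "k < N" for k
    using that p(1)[OF that] by (auto simp: poly_eq_iff u_def coeff_sum coeff_monom)
  obtain i where i: "coeff (p k) i \<noteq> 0" using p(3) by (auto simp: poly_eq_iff)
  then have "i < n" using p(1)[OF p(2)] by (meson not_less)
  then have "i * N + k < n * N" "u (i * N + k) \<noteq> 0"
    using block_index_less p(2) i by (auto simp: u_def)
  moreover have "(\<Sum>r<n * N. u r * gram g n $$ (r, c)) = 0" if c: "c < n * N" for c
  proof -
    have cN: "c div N < n" "c mod N < N"
      using c p(2) by (auto simp: less_mult_imp_div_less)
    show ?thesis
      using sum_gram[OF cN, of u g] p(4)[OF cN] by (simp add: pk)
  qed
  ultimately show "det (gram g n) = 0"
    unfolding det_0_iff_row_kernel[OF gram_carrier] by blast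
qed

text \<open>The criterion is stated for an abstract \<open>L\<close> so that it can serve twice: for
  V_n, and for the transpose of G_n with the indices of \<open>L\<close> swapped. Invertibility of
  \<open>\<Omega>\<close> ties a row combination of \<open>P\<close> to its pairing with x^n, and
  \<open>hankel\<close> makes a row of degree at most \<open>n\<close> determined by its pairings
  with 1, ..., x^n.\<close>

lemma zero_iff_det_gram_0:
  assumes P: "P \<in> carrier_mat N N"
    and deg: "\<And>i k. i < N \<Longrightarrow> k < N \<Longrightarrow> degree (P $$ (i, k)) \<le> n"
    and \<Omega>: "\<Omega> \<in> carrier_mat N N" "det \<Omega> \<noteq> 0"
    and orth: "\<And>m i l. m \<le> n \<Longrightarrow> i < N \<Longrightarrow> l < N \<Longrightarrow>
      (\<Sum>k<N. L k l (P $$ (i, k) * monom 1 m)) = (if m = n then \<Omega> $$ (i, l) else 0)"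
    and hankel: "det (gram 1 (Suc n)) \<noteq> 0"
  shows "poly (det P) z = 0 \<longleftrightarrow> det (gram [:-z, 1:] n) = 0"
proof -
  have row_comb: "(\<Sum>k<N. L k l ((\<Sum>i<N. smult (c i) (P $$ (i, k))) * monom 1 m)) =
      (if m = n then \<Sum>i<N. c i * \<Omega> $$ (i, l) else 0)" if "m \<le> n" "l < N" for c m l
  proof -
    have "(\<Sum>k<N. L k l ((\<Sum>i<N. smult (c i) (P $$ (i, k))) * monom 1 m)) =
        (\<Sum>i<N. c i * (\<Sum>k<N. L k l (P $$ (i, k) * monom 1 m)))"
      using that(2) by (simp add: L_sum_smult_mult sum_distrib_left) (rule sum.swap)
    also have "\<dots> = (if m = n then \<Sum>i<N. c i * \<Omega> $$ (i, l) else 0)"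
      using that orth by simp
    finally show ?thesis .
  qed
  \<comment> \<open>The kernel condition u P(z) = 0 is phrased as vanishing at \<open>z\<close> of
    the polynomial row u P, ready for division by x - z.\<close>
  have eval: "poly (det P) z = 0 \<longleftrightarrow>
      (\<exists>u. (\<exists>i<N. u i \<noteq> 0) \<and> (\<forall>k<N. poly (\<Sum>i<N. smult (u i) (P $$ (i, k))) z = 0))"
  proof -
    have "(\<Sum>i<N. u i * map_mat (\<lambda>p. poly p z) P $$ (i, k)) =
        poly (\<Sum>i<N. smult (u i) (P $$ (i, k))) z" if "k < N" for u k
      using P that by (simp add: poly_sum)
    moreover have "map_mat (\<lambda>p. poly p z) P \<in> carrier_mat N N" using P by simp
    ultimately show ?thesis
      unfolding poly_det[OF P] by (simp add: det_0_iff_row_kernel)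
  qed
  show ?thesis
  proof
    assume "poly (det P) z = 0"
    then obtain u i0 where u: "i0 < N" "u i0 \<noteq> 0"
      "\<And>k. k < N \<Longrightarrow> poly (\<Sum>i<N. smult (u i) (P $$ (i, k))) z = 0"
      unfolding eval by blast
    define q where "q k = (\<Sum>i<N. smult (u i) (P $$ (i, k)))" for k
    have q_pair: "(\<Sum>k<N. L k l (q k * monom 1 m)) =
        (if m = n then \<Sum>i<N. u i * \<Omega> $$ (i, l) else 0)" if "m \<le> n" "l < N" for m l
      unfolding q_def using that by (rule row_comb)
    define r where "r k = q k div [:-z, 1:]" for k
    have q_eq: "q k = [:-z, 1:] * r k" if "k < N" for k
      using u(3)[OF that] unfolding q_def r_def poly_eq_0_iff_dvd
      by (rule dvd_mult_div_cancel[symmetric])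
    have deg_q: "degree (q k) \<le> n" if "k < N" for k
      unfolding q_def using that deg
      by (intro degree_sum_le) (auto intro: order_trans[OF degree_smult_le])
    \<comment> \<open>Dividing by x - z lowers the degree by one, which turns the bound
      \<open>n\<close> for \<open>q\<close> into a strict one for \<open>r\<close>.\<close>
    have "coeff (r k) i = 0" if "k < N" "i \<ge> n" for k i
    proof (cases "r k = 0")
      case False
      then have "degree (q k) = Suc (degree (r k))"
        unfolding q_eq[OF that(1)] by (subst degree_mult_eq) (simp_all del: mult_pCons_left)
      then show ?thesis using deg_q[OF that(1)] that(2) by (intro coeff_eq_0) simp
    qed simp
    \<comment> \<open>If \<open>r\<close> vanished, so would \<open>q\<close>, and pairing with x^n
      would put the nonzero \<open>u\<close> in the left kernel of \<open>\<Omega>\<close>.\<close>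
    moreover have "\<exists>k<N. r k \<noteq> 0"
    proof (rule ccontr)
      assume "\<not> (\<exists>k<N. r k \<noteq> 0)"
      then have "\<forall>k<N. q k = 0" using q_eq by simp
      then have "(\<Sum>i<N. u i * \<Omega> $$ (i, l)) = 0" if "l < N" for l
        using q_pair[of n l] that by (simp add: L_0)
      with \<Omega> u(1,2) show False by (auto simp: det_0_iff_row_kernel)
    qed
    moreover have "(\<Sum>k<N. L k l ([:-z, 1:] * r k * monom 1 m)) = 0" if "m < n" "l < N" for m l
    proof -
      have "(\<Sum>k<N. L k l ([:-z, 1:] * r k * monom 1 m)) = (\<Sum>k<N. L k l (q k * monom 1 m))"
        by (intro sum.cong refl) (simp only: q_eq lessThan_iff)
      then show ?thesis using q_pair[of m l] that by simp
    qed
    ultimately show "det (gram [:-z, 1:] n) = 0"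
      unfolding det_gram_0_iff by (intro exI[of _ r]) blast
  next
    assume "det (gram [:-z, 1:] n) = 0"
    then obtain r k0 where r: "\<And>k i. k < N \<Longrightarrow> i \<ge> n \<Longrightarrow> coeff (r k) i = 0" "k0 < N" "r k0 \<noteq> 0"
      "\<And>m l. m < n \<Longrightarrow> l < N \<Longrightarrow> (\<Sum>k<N. L k l ([:-z, 1:] * r k * monom 1 m)) = 0"
      unfolding det_gram_0_iff by blast
    define q where "q k = [:-z, 1:] * r k" for k
    \<comment> \<open>The candidate kernel vector \<open>c\<close> is chosen so that c P and
      \<open>q\<close> have the same pairing with x^n. Their pairings with lower powers are all 0,
      so the difference is orthogonal to every power up to \<open>n\<close>.\<close>
    obtain c where c: "\<And>l. l < N \<Longrightarrow> (\<Sum>i<N. c i * \<Omega> $$ (i, l)) = (\<Sum>k<N. L k l (q k * monom 1 n))"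
      by (rule row_system_solvable[OF \<Omega>, where b = "\<lambda>l. \<Sum>k<N. L k l (q k * monom 1 n)"])
        (rule that)
    define s where "s k = (\<Sum>i<N. smult (c i) (P $$ (i, k)))" for k
    have s_pair: "(\<Sum>k<N. L k l (s k * monom 1 m)) =
        (if m = n then \<Sum>i<N. c i * \<Omega> $$ (i, l) else 0)" if "m \<le> n" "l < N" for m l
      unfolding s_def using that by (rule row_comb)
    have "coeff (q k - s k) i = 0" if "k < N" "i \<ge> Suc n" for k i
    proof -
      have "coeff (s k) i = 0"
        unfolding s_def coeff_sum using that le_less_trans[OF deg, of _ k i]
        by (intro sum.neutral) (auto intro!: coeff_eq_0)
      moreover have "coeff (q k) i = 0"
        using that r(1)[OF that(1)] by (cases i) (auto simp: q_def)
      ultimately show ?thesis by simp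
    qed
    moreover have "(\<Sum>k<N. L k l (1 * (q k - s k) * monom 1 m)) = 0" if "m < Suc n" "l < N" for m l
    proof -
      have "(\<Sum>k<N. L k l (1 * (q k - s k) * monom 1 m)) =
          (\<Sum>k<N. L k l (q k * monom 1 m)) - (\<Sum>k<N. L k l (s k * monom 1 m))"
        using that(2) by (simp add: left_diff_distrib L_diff sum_subtractf)
      also have "\<dots> = 0"
      proof (cases "m = n")
        case True
        then show ?thesis using s_pair[of n l] c[OF that(2)] that(2) by simp
      next
        case False
        then have "m < n" using that(1) by simp
        then have "(\<Sum>k<N. L k l (q k * monom 1 m)) = 0"
          unfolding q_def using that(2) by (rule r(4))
        then show ?thesis using s_pair[of m l] \<open>m < n\<close> that(2) by simp
      qed
      finally show ?thesis .
    qed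
    \<comment> \<open>A nonzero difference would be a left kernel element of the Hankel matrix with
      \<open>n + 1\<close> block rows; hence \<open>q = s\<close>, and the row c P inherits the
      factor x - z.\<close>
    ultimately have "det (gram 1 (Suc n)) = 0" if "\<exists>k<N. q k - s k \<noteq> 0"
      unfolding det_gram_0_iff using that by (intro exI[of _ "\<lambda>k. q k - s k"]) blast
    with hankel have qs: "q k = s k" if "k < N" for k using that by force
    \<comment> \<open>A zero \<open>c\<close> would give \<open>q k0 = 0\<close>, although
      \<open>q k0\<close> is x - z times the nonzero \<open>r k0\<close>.\<close>
    have "\<exists>i<N. c i \<noteq> 0"
    proof (rule ccontr)
      assume "\<not> (\<exists>i<N. c i \<noteq> 0)"
      then have "q k0 = 0" using qs[OF r(2)] by (simp add: s_def)
      then show False using r(3) by (simp add: q_def del: mult_pCons_left)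
    qed
    moreover have "poly (s k) z = 0" if "k < N" for k
      unfolding qs[OF that, symmetric] by (simp add: q_def)
    ultimately show "poly (det P) z = 0" unfolding eval s_def by blast
  qed
qed

end

section \<open>Matrix integrals expressed through linear functionals on polynomials\<close>

lemma degree_le_mat_poly_degree:
  assumes "P \<in> carrier_mat N N" "i < N" "k < N"
  shows "degree (P $$ (i, k)) \<le> mat_poly_degree P"
proof -
  have "finite (elements_mat P)"
    by (simp add: elements_mat_def)
  then show ?thesis
    unfolding mat_poly_degree_def using assms by (intro Max_ge) auto
qed

definition poly_integral :: "(real set \<Rightarrow> complex) \<Rightarrow> complex poly \<Rightarrow> complex" where
  "poly_integral \<nu> p = complex_measure_integral \<nu> (\<lambda>x. poly p (of_real x))"

text \<open>The Bochner integral is 0 by default on non-integrable functions, so additivity rests on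
  integrability of all polynomials, which follows from that of the powers.\<close>

locale finite_moments =
  fixes \<nu> :: "real set \<Rightarrow> complex"
  assumes moments: "complex_measure_integrable \<nu> (\<lambda>x. of_real x ^ n)"
begin

lemma poly_integrable: "complex_measure_integrable \<nu> (\<lambda>x. poly p (of_real x))"
  using moments unfolding complex_measure_integrable_def poly_altdef
  by (auto intro!: Bochner_Integration.integrable_sum)

lemma poly_integral_add: "poly_integral \<nu> (p + q) = poly_integral \<nu> p + poly_integral \<nu> q"
  using poly_integrable[of p] poly_integrable[of q]
  unfolding poly_integral_def complex_measure_integral_def complex_measure_integrable_def
  by (simp add: algebra_simps)

lemma poly_integral_smult: "poly_integral \<nu> (smult a p) = a * poly_integral \<nu> p"
  unfolding poly_integral_def complex_measure_integral_def by (simp add: algebra_simps)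

end

lemma poly_x_power:
  assumes "l < N" "j < N"
  shows "poly (x_power N m $$ (l, j)) x = (if l = j then x ^ m else 0)"
  using assms by (simp add: x_power_def poly_monom)

text \<open>The factor x^m I is diagonal, so only \<open>l = j\<close> survives in the double
  sum.\<close>

lemma mat_integral_x_power_right:
  assumes "i < N" "j < N"
  shows "mat_integral N W P (x_power N m) $$ (i, j) =
    (\<Sum>k<N. poly_integral (W $$ (k, j)) (P $$ (i, k) * monom 1 m))"
proof -
  have "(\<Sum>l<N. complex_measure_integral (W $$ (k, l))
         (\<lambda>x. poly (P $$ (i, k)) (of_real x) * poly (x_power N m $$ (l, j)) (of_real x))) =
       (\<Sum>l<N. if l = j then poly_integral (W $$ (k, j)) (P $$ (i, k) * monom 1 m) else 0)" for k
    by (intro sum.cong refl)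
      (use assms in \<open>auto simp: poly_x_power poly_integral_def poly_monom complex_measure_integral_def\<close>)
  then show ?thesis using assms by (simp add: mat_integral_def)
qed

text \<open>Here the outer sum collapses. A column of \<open>Q\<close> is paired with a row of
  \<open>W\<close>, the transposed arrangement of the right-hand version.\<close>

lemma mat_integral_x_power_left:
  assumes "i < N" "j < N"
  shows "mat_integral N W (x_power N m) Q $$ (i, j) =
    (\<Sum>l<N. poly_integral (W $$ (i, l)) (Q $$ (l, j) * monom 1 m))"
proof -
  have "(\<Sum>l<N. complex_measure_integral (W $$ (k, l))
         (\<lambda>x. poly (x_power N m $$ (i, k)) (of_real x) * poly (Q $$ (l, j)) (of_real x))) =
       (if i = k then \<Sum>l<N. poly_integral (W $$ (i, l)) (Q $$ (l, j) * monom 1 m) else 0)"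
    if "k < N" for k
    using assms that
    by (auto simp: poly_x_power poly_integral_def poly_monom complex_measure_integral_def mult.commute)
  then show ?thesis using assms by (simp add: mat_integral_def)
qed

theorem theorem2:
  fixes N :: nat
    and W :: "(real set \<Rightarrow> complex) mat"
    and V G :: "nat \<Rightarrow> complex poly mat"
  assumes "N \<ge> 1"
    and "quasidefinite N W"
    and "moment N W 0 = 1\<^sub>m N"
    and "biorthogonal N W V G"
    and "V 0 = 1\<^sub>m N"
    and "G 0 = 1\<^sub>m N"
  shows "\<forall>n. mat_poly_zeros (V n) = mat_poly_zeros (G n)"
proof
  fix n
  obtain \<Omega>1 \<Omega>2 where
    V: "V n \<in> carrier_mat N N" "mat_poly_degree (V n) = n" and
    G: "G n \<in> carrier_mat N N" "mat_poly_degree (G n) = n" and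
    \<Omega>1: "\<Omega>1 n \<in> carrier_mat N N" "det (\<Omega>1 n) \<noteq> 0" and
    \<Omega>2: "\<Omega>2 n \<in> carrier_mat N N" "det (\<Omega>2 n) \<noteq> 0" and
    orth1: "\<And>m. m \<le> n \<Longrightarrow>
      mat_integral N W (V n) (x_power N m) = (if n = m then \<Omega>1 n else 0\<^sub>m N N)" and
    orth2: "\<And>m. m \<le> n \<Longrightarrow>
      mat_integral N W (x_power N m) (G n) = (if n = m then \<Omega>2 n else 0\<^sub>m N N)"
    using assms(4) unfolding biorthogonal_def by metis
  have moments: "finite_moments (W $$ (k, l))" if "k < N" "l < N" for k l
    using assms(2) that by (simp add: quasidefinite_def finite_moments_def)
  define L where "L k l = poly_integral (W $$ (k, l))" for k l
  interpret row: functional_matrix N L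
    by unfold_locales
      (simp_all add: L_def moments finite_moments.poly_integral_add finite_moments.poly_integral_smult)
  \<comment> \<open>Transposing \<open>W\<close> turns the column relations for \<open>G n\<close>
    into row relations for its transpose.\<close>
  interpret col: functional_matrix N "\<lambda>k l. L l k"
    by unfold_locales (simp_all add: row.L_add row.L_smult)
  \<comment> \<open>Blocks depend only on the sum of the block indices, so transposing the whole
    matrix just transposes each block.\<close>
  have "col.gram g m = (row.gram g m)\<^sup>T" for g m
    by (rule eq_matI) (auto simp: row.gram_def col.gram_def add.commute)
  then have det_col: "det (col.gram g m) = det (row.gram g m)" for g m
    using det_transpose[OF row.gram_carrier] by simp
  \<comment> \<open>\<open>block_hankel\<close> counts its blocks from 0 to \<open>m\<close>, whence
    the successor; \<open>N \<ge> 1\<close> keeps the remainders modulo \<open>N\<close> in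
    range.\<close>
  have "row.gram 1 (Suc m) = block_hankel N (moment N W) m" for m
    using \<open>N \<ge> 1\<close>
    by (intro eq_matI)
      (simp_all add: row.gram_def block_hankel_def moment_def L_def poly_integral_def poly_monom)
  then have hankel: "det (row.gram 1 (Suc n)) \<noteq> 0"
    using assms(2) by (simp add: quasidefinite_def)
  have "poly (det (V n)) z = 0 \<longleftrightarrow> det (row.gram [:-z, 1:] n) = 0" for z
  proof (rule row.zero_iff_det_gram_0[OF V(1) _ \<Omega>1 _ hankel])
    show "degree (V n $$ (i, k)) \<le> n" if "i < N" "k < N" for i k
      using degree_le_mat_poly_degree[OF V(1) that] V(2) by simp
    show "(\<Sum>k<N. L k l (V n $$ (i, k) * monom 1 m)) = (if m = n then \<Omega>1 n $$ (i, l) else 0)"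
      if "m \<le> n" "i < N" "l < N" for m i l
      using mat_integral_x_power_right[OF that(2,3), of W "V n" m] orth1[OF that(1)] that
      by (auto simp: L_def)
  qed
  moreover have "poly (det ((G n)\<^sup>T)) z = 0 \<longleftrightarrow> det (col.gram [:-z, 1:] n) = 0" for z
  proof (rule col.zero_iff_det_gram_0)
    show "(G n)\<^sup>T \<in> carrier_mat N N" "(\<Omega>2 n)\<^sup>T \<in> carrier_mat N N" "det ((\<Omega>2 n)\<^sup>T) \<noteq> 0"
      using G \<Omega>2 by (simp_all add: det_transpose)
    show "det (col.gram 1 (Suc n)) \<noteq> 0" using hankel by (simp add: det_col)
    show "degree ((G n)\<^sup>T $$ (i, k)) \<le> n" if "i < N" "k < N" for i k
      using degree_le_mat_poly_degree[OF G(1) that(2,1)] G that by simp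
    show "(\<Sum>k<N. L l k ((G n)\<^sup>T $$ (i, k) * monom 1 m)) = (if m = n then (\<Omega>2 n)\<^sup>T $$ (i, l) else 0)"
      if "m \<le> n" "i < N" "l < N" for m i l
      using mat_integral_x_power_left[OF that(3,2), of W m "G n"] orth2[OF that(1)] that G \<Omega>2
      by (auto simp: L_def)
  qed
  ultimately show "mat_poly_zeros (V n) = mat_poly_zeros (G n)"
    using det_transpose[OF G(1)] by (simp add: mat_poly_zeros_def det_col)
qed

end
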